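(* Consider the one-dimensional heat equation $\frac{\partial u}{\partial t}(x,t)=\frac{\partial^2 u}{\partial x^2}(x,t)$, $(x,t)\in I\times[0,T]$, where $I$ is a given open subset of $\mathbb{R}$ (bounded or not) and $T>0$. With a constant time step $k$ and a constant mesh size $h$, let (FD$_2$) be the implicit finite differences scheme $$-\frac{k}{2h^2}\,\tilde u_{j-1}^{(n+1)}+\Big(1+\frac{k}{h^2}\Big)\tilde u_j^{(n+1)}-\frac{k}{2h^2}\,\tilde u_{j+1}^{(n+1)}=\frac{k}{2h^2}\Big(\tilde u_{j-1}^{(n)}+\tilde u_{j+1}^{(n)}\Big)+\Big(1-\frac{k}{h^2}\Big)\tilde u_j^{(n)}.$$ Then the scheme (FD$_2$) is consistent with the heat equation. It is first-order accurate in $k$ (time) and second-order accurate in $h$ (space), that is, in $O(k)$ and $O(h^2)$. Moreover, for $m_2\ge 0$, where $m_2$ is a lower bound of $\frac{\partial^2 u}{\partial t^2}$, the error estimate bound in $k$ is at least two times smaller than that of the classical implicit finite differences scheme. Finally, when $I=\mathbb{R}$, the scheme (FD$_2$) is unconditionally stable.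
   Context: Discrete times are $t^{(n)}=nk$ ($n\in\mathbb{N}$), mesh nodes are $x_j=jh$, and $\tilde u_j^{(n)}$ denotes an approximation of $u(x_j,t^{(n)})$. The solution $u$ of the heat equation is assumed to be $C^2$ in time, and $m_2,M_2\in\mathbb{R}$ denote lower and upper bounds of its second time derivative: $m_2\le\frac{\partial^2u}{\partial t^2}(\cdot,t)\le M_2$ for all $t\in[0,T]$. The classical implicit finite differences scheme is $$\frac{\tilde u_j^{(n+1)}-\tilde u_j^{(n)}}{k}=\frac{\tilde u_{j-1}^{(n+1)}-2\tilde u_j^{(n+1)}+\tilde u_{j+1}^{(n+1)}}{h^2}.$$ The error estimate bounds in $k$ being compared are the following. For the classical scheme, one writes $\frac{\partial u}{\partial t}(x,t^{(n)})=\frac{u(x,t^{(n+1)})-u(x,t^{(n)})}{k}+\epsilon_n^{(T)}$, with bound $|\epsilon_n^{(T)}|\le\frac{k}{2}\max(|m_2|,|M_2|)$. For (FD$_2$), one writes $\frac{\partial u}{\partial t}(x,t^{(n)})=\frac{2}{k}\big(u(x,t^{(n+1)})-u(x,t^{(n)})\big)-\frac{\partial^2u}{\partial x^2}(x,t^{(n+1)})-2\epsilon_n$, with bound $|2\epsilon_n|\le\frac{k}{4}(M_2-m_2)$. "Unconditionally stable" means stable with no condition relating $k$ and $h$. Stability is studied in the usual way by inserting $\tilde u_j^{(n)}=A^ne^{ipx_j}$ ($p$ a real parameter) in the scheme, the necessary stability condition being $|A|\le 1$. *)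

theory Defs
  imports "HOL-Analysis.Analysis"
begin

text \<open>Functions \<open>u x t\<close> live on \<open>I \<times> {0..T}\<close>. Time derivatives are taken within the closed interval
  (one-sided at \<open>0\<close> and \<open>T\<close>); space derivatives are ordinary ones, as \<open>I\<close> is open.\<close>

definition dt :: "real \<Rightarrow> (real \<Rightarrow> real \<Rightarrow> real) \<Rightarrow> real \<Rightarrow> real \<Rightarrow> real" where
  "dt T u x t = vector_derivative (u x) (at t within {0..T})"

definition dtt :: "real \<Rightarrow> (real \<Rightarrow> real \<Rightarrow> real) \<Rightarrow> real \<Rightarrow> real \<Rightarrow> real" where
  "dtt T u = dt T (dt T u)"

definition dx :: "(real \<Rightarrow> real \<Rightarrow> real) \<Rightarrow> real \<Rightarrow> real \<Rightarrow> real" where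
  "dx u x t = deriv (\<lambda>y. u y t) x"

definition dxx :: "(real \<Rightarrow> real \<Rightarrow> real) \<Rightarrow> real \<Rightarrow> real \<Rightarrow> real" where
  "dxx u = dx (dx u)"

definition heat_solution :: "real set \<Rightarrow> real \<Rightarrow> (real \<Rightarrow> real \<Rightarrow> real) \<Rightarrow> bool" where
  "heat_solution I T u \<longleftrightarrow>
     (\<forall>x\<in>I. \<forall>t\<in>{0..T}.
        u x differentiable (at t within {0..T}) \<and>
        (\<lambda>y. u y t) differentiable (at x) \<and>
        (\<lambda>y. dx u y t) differentiable (at x) \<and>
        dt T u x t = dxx u x t)"

definition C2_in_time :: "real set \<Rightarrow> real \<Rightarrow> (real \<Rightarrow> real \<Rightarrow> real) \<Rightarrow> bool" where
  "C2_in_time I T u \<longleftrightarrow>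
     (\<forall>x\<in>I. u x differentiable_on {0..T} \<and> dt T u x differentiable_on {0..T} \<and>
            continuous_on {0..T} (dtt T u x))"

definition regular_solution ::
  "real set \<Rightarrow> real \<Rightarrow> real \<Rightarrow> real \<Rightarrow> (real \<Rightarrow> real \<Rightarrow> real) \<Rightarrow> bool" where
  "regular_solution I T m2 M2 u \<longleftrightarrow>
     heat_solution I T u \<and> C2_in_time I T u \<and>
     (\<forall>x\<in>I. \<forall>t\<in>{0..T}. m2 \<le> dtt T u x t \<and> dtt T u x t \<le> M2)"

text \<open>A grid function \<open>v j n\<close> stands for the value at node \<open>j * h\<close> and time \<open>n * k\<close>. The value type is
  left open, because the scheme is applied to real grid functions and to complex Fourier modes.\<close>

definition fd2_lhs :: "real \<Rightarrow> real \<Rightarrow> (int \<Rightarrow> nat \<Rightarrow> 'a::real_vector) \<Rightarrow> int \<Rightarrow> nat \<Rightarrow> 'a" where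
  "fd2_lhs k h v j n =
     (- (k / (2 * h\<^sup>2))) *\<^sub>R v (j - 1) (n + 1) + (1 + k / h\<^sup>2) *\<^sub>R v j (n + 1)
     - (k / (2 * h\<^sup>2)) *\<^sub>R v (j + 1) (n + 1)"

definition fd2_rhs :: "real \<Rightarrow> real \<Rightarrow> (int \<Rightarrow> nat \<Rightarrow> 'a::real_vector) \<Rightarrow> int \<Rightarrow> nat \<Rightarrow> 'a" where
  "fd2_rhs k h v j n =
     (k / (2 * h\<^sup>2)) *\<^sub>R (v (j - 1) n + v (j + 1) n) + (1 - k / h\<^sup>2) *\<^sub>R v j n"

definition FD2 :: "real \<Rightarrow> real \<Rightarrow> (int \<Rightarrow> nat \<Rightarrow> 'a::real_vector) \<Rightarrow> int \<Rightarrow> nat \<Rightarrow> bool" where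
  "FD2 k h v j n \<longleftrightarrow> fd2_lhs k h v j n = fd2_rhs k h v j n"

definition grid_fn :: "real \<Rightarrow> real \<Rightarrow> (real \<Rightarrow> real \<Rightarrow> 'a) \<Rightarrow> int \<Rightarrow> nat \<Rightarrow> 'a" where
  "grid_fn k h u = (\<lambda>j n. u (real_of_int j * h) (real n * k))"

text \<open>The scheme is written multiplied by \<open>k\<close>; dividing by \<open>k\<close> gives the truncation error in the
  normalisation of \<open>u\<^sub>t - u\<^sub>x\<^sub>x\<close>, namely
  \<open>(u\<^sub>j\<^sup>n\<^sup>+\<^sup>1 - u\<^sub>j\<^sup>n) / k\<close> minus the mean of the central second differences at the two time levels.\<close>

definition fd2_truncation :: "real \<Rightarrow> real \<Rightarrow> (real \<Rightarrow> real \<Rightarrow> real) \<Rightarrow> int \<Rightarrow> nat \<Rightarrow> real" where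
  "fd2_truncation k h u j n =
     (fd2_lhs k h (grid_fn k h u) j n - fd2_rhs k h (grid_fn k h u) j n) / k"

text \<open>Since \<open>I\<close> need not be an interval, the whole stencil segment has to lie in \<open>I\<close>.\<close>

definition admissible :: "real set \<Rightarrow> real \<Rightarrow> real \<Rightarrow> real \<Rightarrow> int \<Rightarrow> nat \<Rightarrow> bool" where
  "admissible I T k h j n \<longleftrightarrow>
     {real_of_int (j - 1) * h .. real_of_int (j + 1) * h} \<subseteq> I \<and> real (n + 1) * k \<le> T"

text \<open>For consistency and order of accuracy, \<open>\<tau> k h u\<close> is the truncation error of a scheme at \<open>u\<close>.\<close>

definition consistent_with_heat ::
  "real set \<Rightarrow> real \<Rightarrow> (real \<Rightarrow> real \<Rightarrow> (real \<Rightarrow> real \<Rightarrow> real) \<Rightarrow> int \<Rightarrow> nat \<Rightarrow> real) \<Rightarrow> bool" where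
  "consistent_with_heat I T \<tau> \<longleftrightarrow>
     (\<forall>u m2 M2. regular_solution I T m2 M2 u \<longrightarrow>
        (\<forall>e>0. \<exists>d>0. \<forall>k h j n. 0 < k \<and> k < d \<and> 0 < h \<and> h < d \<and> admissible I T k h j n \<longrightarrow>
           \<bar>\<tau> k h u j n\<bar> < e))"

definition accurate_of_order ::
  "real set \<Rightarrow> real \<Rightarrow> nat \<Rightarrow> nat \<Rightarrow>
   (real \<Rightarrow> real \<Rightarrow> (real \<Rightarrow> real \<Rightarrow> real) \<Rightarrow> int \<Rightarrow> nat \<Rightarrow> real) \<Rightarrow> bool" where
  "accurate_of_order I T p q \<tau> \<longleftrightarrow>
     (\<forall>u m2 M2. regular_solution I T m2 M2 u \<longrightarrow>
        (\<exists>C. \<exists>d>0. \<forall>k h j n. 0 < k \<and> k < d \<and> 0 < h \<and> h < d \<and> admissible I T k h j n \<longrightarrow>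
           \<bar>\<tau> k h u j n\<bar> \<le> C * (k ^ p + h ^ q)))"

text \<open>Errors of the approximations of \<open>u\<^sub>t\<close> at \<open>(x, n * k)\<close>. For the classical implicit scheme
  \<open>u\<^sub>t = (u\<^sup>n\<^sup>+\<^sup>1 - u\<^sup>n) / k + \<epsilon>\<close>; for FD2,
  \<open>u\<^sub>t = (2 / k) (u\<^sup>n\<^sup>+\<^sup>1 - u\<^sup>n) - u\<^sub>x\<^sub>x\<^sup>n\<^sup>+\<^sup>1 - 2 \<epsilon>\<close>.\<close>

definition classical_eps :: "real \<Rightarrow> real \<Rightarrow> (real \<Rightarrow> real \<Rightarrow> real) \<Rightarrow> real \<Rightarrow> nat \<Rightarrow> real" where
  "classical_eps T k u x n =
     dt T u x (real n * k) - (u x (real (n + 1) * k) - u x (real n * k)) / k"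

definition fd2_eps :: "real \<Rightarrow> real \<Rightarrow> (real \<Rightarrow> real \<Rightarrow> real) \<Rightarrow> real \<Rightarrow> nat \<Rightarrow> real" where
  "fd2_eps T k u x n =
     (2 / k * (u x (real (n + 1) * k) - u x (real n * k)) - dxx u x (real (n + 1) * k)
      - dt T u x (real n * k)) / 2"

definition classical_bound :: "real \<Rightarrow> real \<Rightarrow> real \<Rightarrow> real" where
  "classical_bound m2 M2 k = k / 2 * max \<bar>m2\<bar> \<bar>M2\<bar>"

definition fd2_bound :: "real \<Rightarrow> real \<Rightarrow> real \<Rightarrow> real" where
  "fd2_bound m2 M2 k = k / 4 * (M2 - m2)"

text \<open>Von Neumann stability on the whole line: every wave number has an amplification factor \<open>A\<close>, and
  every such factor satisfies \<open>\<bar>A\<bar> \<le> 1\<close>.\<close>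

definition fourier_mode :: "real \<Rightarrow> real \<Rightarrow> complex \<Rightarrow> int \<Rightarrow> nat \<Rightarrow> complex" where
  "fourier_mode h p A = (\<lambda>j n. A ^ n * exp (\<i> * of_real (p * (real_of_int j * h))))"

definition von_neumann_stable ::
  "(real \<Rightarrow> real \<Rightarrow> (int \<Rightarrow> nat \<Rightarrow> complex) \<Rightarrow> int \<Rightarrow> nat \<Rightarrow> bool) \<Rightarrow> real \<Rightarrow> real \<Rightarrow> bool" where
  "von_neumann_stable S k h \<longleftrightarrow>
     (\<forall>p. (\<exists>A. \<forall>j n. S k h (fourier_mode h p A) j n) \<and>
          (\<forall>A. (\<forall>j n. S k h (fourier_mode h p A) j n) \<longrightarrow> cmod A \<le> 1))"

definition unconditionally_stable ::
  "(real \<Rightarrow> real \<Rightarrow> (int \<Rightarrow> nat \<Rightarrow> complex) \<Rightarrow> int \<Rightarrow> nat \<Rightarrow> bool) \<Rightarrow> bool" where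
  "unconditionally_stable S \<longleftrightarrow> (\<forall>k>0. \<forall>h>0. von_neumann_stable S k h)"

end

theory Submission
  imports Defs
begin

text \<open>Write \<open>w = u\<^sub>t = u\<^sub>x\<^sub>x\<close>. The FD2 bound in time compares the Taylor expansions of \<open>u\<close> from both ends
  of a time step at its midpoint.

  The regularity assumptions contain no fourth space derivative of \<open>u\<close>; instead, the centred second
  differences of \<open>w\<close> in space are estimated. A difference quotient \<open>(u(x,s) - u(x,t)) / (s - t)\<close> has
  the second space derivative \<open>(w(x,s) - w(x,t)) / (s - t)\<close>, which lies in \<open>[m\<^sub>2, M\<^sub>2]\<close> because
  \<open>w\<^sub>t = u\<^sub>t\<^sub>t\<close> does. Hence its second difference with step \<open>r\<close> lies in \<open>[m\<^sub>2 r\<^sup>2, M\<^sub>2 r\<^sup>2]\<close>, and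
  letting \<open>s\<close> tend to \<open>t\<close> gives the same for \<open>w\<close>. Since \<open>w = u\<^sub>x\<^sub>x\<close>, two integrations in \<open>r\<close> give
  the second difference of \<open>u\<close> up to \<open>O(h\<^sup>4)\<close>.

  For a Fourier mode of phase \<open>\<theta> = p h\<close>, the amplification factor is \<open>(1 - c) / (1 + c)\<close> with
  \<open>c = (k / h\<^sup>2) (1 - cos \<theta>) \<ge> 0\<close>.\<close>

section \<open>Mean value and Taylor estimates on a real interval\<close>

lemma has_real_derivative_mvt:
  fixes f f' :: "real \<Rightarrow> real"
  assumes "\<And>s. s \<in> {a..b} \<Longrightarrow> (f has_real_derivative f' s) (at s within {a..b})"
    and "x \<in> {a..b}" "y \<in> {a..b}"
  obtains z where "z \<in> {min x y..max x y}" "f y - f x = f' z * (y - x)"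
proof -
  have *: "\<exists>z\<in>{x..y}. f y - f x = f' z * (y - x)" if "x \<le> y" "x \<in> {a..b}" "y \<in> {a..b}" for x y
  proof -
    have sub: "{x..y} \<subseteq> {a..b}" using that by auto
    have "(f has_derivative (*) (f' s)) (at s within {x..y})" if "x \<le> s" "s \<le> y" for s
      using DERIV_subset[OF assms(1) sub] that sub
      by (auto simp: has_field_derivative_def)
    from mvt_very_simple[OF \<open>x \<le> y\<close> this] show ?thesis by simp
  qed
  show thesis
  proof (cases "x \<le> y")
    case True
    then show ?thesis using *[OF True assms(2,3)] that by (auto simp: min_def max_def)
  next
    case False
    then have "y \<le> x" by simp
    from *[OF this assms(3,2)] obtain z where "z \<in> {y..x}" "f x - f y = f' z * (x - y)" by blast
    then have "z \<in> {min x y..max x y}" "f y - f x = f' z * (y - x)"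
      using False by (auto simp: algebra_simps)
    then show ?thesis using that by blast
  qed
qed

text \<open>Two mean value steps write the difference as \<open>f'' v * ((z - x) * (y - x))\<close>.
  As \<open>z\<close> lies between \<open>x\<close> and \<open>y\<close>, the last two factors do
  not have opposite signs, whether \<open>y\<close> is to the right or to the left of
  \<open>x\<close>.\<close>

lemma tangent_below_if_second_derivative_nonneg:
  fixes f f' f'' :: "real \<Rightarrow> real"
  assumes d1: "\<And>s. s \<in> {a..b} \<Longrightarrow> (f has_real_derivative f' s) (at s within {a..b})"
    and d2: "\<And>s. s \<in> {a..b} \<Longrightarrow> (f' has_real_derivative f'' s) (at s within {a..b})"
    and nn: "\<And>s. s \<in> {a..b} \<Longrightarrow> 0 \<le> f'' s"
    and x: "x \<in> {a..b}" and y: "y \<in> {a..b}"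
  shows "0 \<le> f y - f x - f' x * (y - x)"
proof -
  obtain z where z: "z \<in> {min x y..max x y}" "f y - f x = f' z * (y - x)"
    using has_real_derivative_mvt[OF d1 x y] by blast
  have zab: "z \<in> {a..b}" using z(1) x y by auto
  obtain v where v: "v \<in> {min x z..max x z}" "f' z - f' x = f'' v * (z - x)"
    using has_real_derivative_mvt[OF d2 x zab] by blast
  have "v \<in> {a..b}" using v(1) x zab by auto
  then have "0 \<le> f'' v" by (rule nn)
  moreover have "0 \<le> (z - x) * (y - x)"
    using z(1) by (auto simp: min_def max_def zero_le_mult_iff split: if_splits)
  moreover have "f y - f x - f' x * (y - x) = f'' v * ((z - x) * (y - x))"
    using z(2) v(2) by (metis left_diff_distrib mult.assoc)
  ultimately show ?thesis by simp
qed

text \<open>Subtracting the parabola of second derivative \<open>m\<close> from \<open>f\<close>, or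
  \<open>f\<close> from the one of second derivative \<open>M\<close>, leaves a function with
  nonnegative second derivative, which stays above its tangent.\<close>

lemma taylor2_bounds:
  fixes f f' f'' :: "real \<Rightarrow> real"
  assumes d1: "\<And>s. s \<in> {a..b} \<Longrightarrow> (f has_real_derivative f' s) (at s within {a..b})"
    and d2: "\<And>s. s \<in> {a..b} \<Longrightarrow> (f' has_real_derivative f'' s) (at s within {a..b})"
    and bd: "\<And>s. s \<in> {a..b} \<Longrightarrow> m \<le> f'' s \<and> f'' s \<le> M"
    and x: "x \<in> {a..b}" and y: "y \<in> {a..b}"
  shows "m / 2 * (y - x)\<^sup>2 \<le> f y - f x - f' x * (y - x)"
    and "f y - f x - f' x * (y - x) \<le> M / 2 * (y - x)\<^sup>2"
proof -
  \<comment> \<open>The terms \<open>x - x\<close> are left unsimplified so that the goal matches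
    the rule at the base point \<open>x\<close>.\<close>
  have "0 \<le> (f y - m / 2 * (y - x)\<^sup>2) - (f x - m / 2 * (x - x)\<^sup>2) - (f' x - m * (x - x)) * (y - x)"
    by (rule tangent_below_if_second_derivative_nonneg
          [where f = "\<lambda>s. f s - m / 2 * (s - x)\<^sup>2" and f' = "\<lambda>s. f' s - m * (s - x)"
            and f'' = "\<lambda>s. f'' s - m" and a = a and b = b])
       (use bd x y in \<open>auto intro!: derivative_eq_intros d1 d2\<close>)
  then show "m / 2 * (y - x)\<^sup>2 \<le> f y - f x - f' x * (y - x)" by simp
  have "0 \<le> (M / 2 * (y - x)\<^sup>2 - f y) - (M / 2 * (x - x)\<^sup>2 - f x) - (M * (x - x) - f' x) * (y - x)"
    by (rule tangent_below_if_second_derivative_nonneg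
          [where f = "\<lambda>s. M / 2 * (s - x)\<^sup>2 - f s" and f' = "\<lambda>s. M * (s - x) - f' s"
            and f'' = "\<lambda>s. M - f'' s" and a = a and b = b])
       (use bd x y in \<open>auto intro!: derivative_eq_intros d1 d2\<close>)
  then show "f y - f x - f' x * (y - x) \<le> M / 2 * (y - x)\<^sup>2" by simp
qed

text \<open>Both ends of the step are expanded to the midpoint \<open>c\<close>, where the unknown
  value \<open>f c\<close> cancels. Because two remainders are subtracted, only the oscillation
  \<open>M - m\<close> of the second derivative enters.\<close>

lemma trapezoid_bound:
  fixes f f' f'' :: "real \<Rightarrow> real"
  assumes "\<And>s. s \<in> {a..b} \<Longrightarrow> (f has_real_derivative f' s) (at s within {a..b})"
    and "\<And>s. s \<in> {a..b} \<Longrightarrow> (f' has_real_derivative f'' s) (at s within {a..b})"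
    and "\<And>s. s \<in> {a..b} \<Longrightarrow> m \<le> f'' s \<and> f'' s \<le> M"
    and "x \<in> {a..b}" "x + k \<in> {a..b}" and k: "0 < k"
  shows "\<bar>2 / k * (f (x + k) - f x) - f' (x + k) - f' x\<bar> \<le> k / 4 * (M - m)"
proof -
  define c where "c = x + k / 2"
  have c: "c \<in> {a..b}" using assms by (auto simp: c_def)
  note L = taylor2_bounds[OF assms(1-3) \<open>x \<in> {a..b}\<close> c]
    and R = taylor2_bounds[OF assms(1-3) \<open>x + k \<in> {a..b}\<close> c]
  have e: "c - x = k / 2" "c - (x + k) = - (k / 2)" by (auto simp: c_def)
  have "m * k\<^sup>2 / 8 \<le> f c - f x - k * f' x / 2" "f c - f x - k * f' x / 2 \<le> M * k\<^sup>2 / 8"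
    "m * k\<^sup>2 / 8 \<le> f c - f (x + k) + k * f' (x + k) / 2"
    "f c - f (x + k) + k * f' (x + k) / 2 \<le> M * k\<^sup>2 / 8"
    using L R unfolding e by (simp_all add: power_divide mult.commute)
  \<comment> \<open>Each remainder lies between \<open>m * k\<^sup>2 / 8\<close> and
    \<open>M * k\<^sup>2 / 8\<close>; the left side is twice their difference.\<close>
  then have "\<bar>2 * f (x + k) - 2 * f x - (k * f' (x + k) + k * f' x)\<bar> \<le> M * k\<^sup>2 / 4 - m * k\<^sup>2 / 4"
    by (intro abs_leI) linarith+
  then have "\<bar>2 * (f (x + k) - f x) - k * (f' (x + k) + f' x)\<bar> \<le> k\<^sup>2 / 4 * (M - m)"
    by (simp add: algebra_simps)
  also have "\<dots> = k * (k / 4 * (M - m))" by (simp add: power2_eq_square)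
  finally have "\<bar>2 * (f (x + k) - f x) - k * (f' (x + k) + f' x)\<bar> \<le> k * (k / 4 * (M - m))" .
  moreover have "2 * (f (x + k) - f x) - k * (f' (x + k) + f' x)
      = k * (2 / k * (f (x + k) - f x) - f' (x + k) - f' x)"
    using k by (simp add: field_simps)
  ultimately show ?thesis using k by (simp only: abs_mult) simp
qed

section \<open>Comparison of second differences with second derivatives\<close>

definition second_difference :: "(real \<Rightarrow> real) \<Rightarrow> real \<Rightarrow> real \<Rightarrow> real" where
  "second_difference f x r = f (x + r) - 2 * f x + f (x - r)"

text \<open>The function \<open>f (x + s) + f (x - s) - p s\<close> of \<open>s\<close> has
  nonnegative second derivative, and its first derivative vanishes at \<open>0\<close> by symmetry
  and \<open>p' 0 = 0\<close>. Hence its value at \<open>r\<close> is at least its value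
  \<open>2 * f x\<close> at \<open>0\<close>.\<close>

lemma second_difference_ge:
  fixes f f' f'' p p' p'' :: "real \<Rightarrow> real"
  assumes f1: "\<And>y. y \<in> {x - r..x + r} \<Longrightarrow> (f has_real_derivative f' y) (at y)"
    and f2: "\<And>y. y \<in> {x - r..x + r} \<Longrightarrow> (f' has_real_derivative f'' y) (at y)"
    and p1: "\<And>y. (p has_real_derivative p' y) (at y)"
    and p2: "\<And>y. (p' has_real_derivative p'' y) (at y)"
    and p0: "p 0 = 0" "p' 0 = 0"
    and le: "\<And>s. s \<in> {0..r} \<Longrightarrow> p'' s \<le> f'' (x + s) + f'' (x - s)"
    and r: "0 \<le> r"
  shows "p r \<le> second_difference f x r"
proof -
  have shift: "((\<lambda>s. g (x + s)) has_real_derivative g' (x + s)) (at s within {0..r})"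
    "((\<lambda>s. g (x - s)) has_real_derivative - g' (x - s)) (at s within {0..r})"
    if "s \<in> {0..r}" "\<And>y. y \<in> {x - r..x + r} \<Longrightarrow> (g has_real_derivative g' y) (at y)"
    for g g' :: "real \<Rightarrow> real" and s
  proof -
    show "((\<lambda>s. g (x + s)) has_real_derivative g' (x + s)) (at s within {0..r})"
      by (rule DERIV_chain2[where f = g and g = "\<lambda>s. x + s" and Db = 1, simplified])
         (use that in \<open>auto intro!: derivative_eq_intros\<close>)
    show "((\<lambda>s. g (x - s)) has_real_derivative - g' (x - s)) (at s within {0..r})"
      by (rule DERIV_chain2[where f = g and g = "\<lambda>s. x - s" and Db = "-1", simplified])
         (use that in \<open>auto intro!: derivative_eq_intros\<close>)
  qed
  have "0 \<le> (f (x + r) + f (x - r) - p r) - (f (x + 0) + f (x - 0) - p 0)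
      - (f' (x + 0) - f' (x - 0) - p' 0) * (r - 0)"
  proof (rule tangent_below_if_second_derivative_nonneg
      [where f = "\<lambda>s. f (x + s) + f (x - s) - p s" and f' = "\<lambda>s. f' (x + s) - f' (x - s) - p' s"
        and f'' = "\<lambda>s. f'' (x + s) + f'' (x - s) - p'' s" and a = 0 and b = r])
    fix s assume s: "s \<in> {0..r}"
    note * = DERIV_subset[OF p1 subset_UNIV] DERIV_subset[OF p2 subset_UNIV]
    show "((\<lambda>s. f (x + s) + f (x - s) - p s) has_real_derivative f' (x + s) - f' (x - s) - p' s)
        (at s within {0..r})"
      using DERIV_diff[OF DERIV_add[OF shift(1)[OF s f1] shift(2)[OF s f1]] *(1)] by simp
    show "((\<lambda>s. f' (x + s) - f' (x - s) - p' s) has_real_derivative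
        f'' (x + s) + f'' (x - s) - p'' s) (at s within {0..r})"
      using DERIV_diff[OF DERIV_diff[OF shift(1)[OF s f2] shift(2)[OF s f2]] *(2)] by simp
  qed (use r le in auto)
  then show ?thesis by (simp add: second_difference_def p0)
qed

lemma second_difference_le:
  fixes f f' f'' p p' p'' :: "real \<Rightarrow> real"
  assumes "\<And>y. y \<in> {x - r..x + r} \<Longrightarrow> (f has_real_derivative f' y) (at y)"
    and "\<And>y. y \<in> {x - r..x + r} \<Longrightarrow> (f' has_real_derivative f'' y) (at y)"
    and "\<And>y. (p has_real_derivative p' y) (at y)"
    and "\<And>y. (p' has_real_derivative p'' y) (at y)"
    and "p 0 = 0" "p' 0 = 0"
    and "\<And>s. s \<in> {0..r} \<Longrightarrow> f'' (x + s) + f'' (x - s) \<le> p'' s"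
    and "0 \<le> r"
  shows "second_difference f x r \<le> p r"
proof -
  have "- p r \<le> second_difference (\<lambda>y. - f y) x r"
  proof (rule second_difference_ge[where f' = "\<lambda>y. - f' y" and f'' = "\<lambda>y. - f'' y"
        and p' = "\<lambda>y. - p' y" and p'' = "\<lambda>y. - p'' y"])
    fix s assume "s \<in> {0..r}"
    then show "- p'' s \<le> - f'' (x + s) + - f'' (x - s)" using assms(7)[of s] by simp
  qed (use assms in \<open>auto intro!: DERIV_minus\<close>)
  then show ?thesis by (simp add: second_difference_def)
qed

section \<open>Space differences of a regular solution\<close>

lemma regular_solution_time_derivatives:
  assumes "regular_solution I T m2 M2 u" "x \<in> I" "t \<in> {0..T}"
  shows "(u x has_real_derivative dt T u x t) (at t within {0..T})"
    and "(dt T u x has_real_derivative dtt T u x t) (at t within {0..T})"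
    and "m2 \<le> dtt T u x t" "dtt T u x t \<le> M2"
proof -
  have d: "u x differentiable (at t within {0..T})" "dt T u x differentiable (at t within {0..T})"
    using assms unfolding regular_solution_def C2_in_time_def differentiable_on_def by auto
  show "(u x has_real_derivative dt T u x t) (at t within {0..T})"
    using d(1) unfolding has_real_derivative_iff_has_vector_derivative vector_derivative_works dt_def .
  \<comment> \<open>The instantiation unfolds only the outer \<open>dt\<close> and keeps the inner
    \<open>dt T u\<close> as the function being differentiated.\<close>
  have "dtt T u x t = vector_derivative (dt T u x) (at t within {0..T})"
    by (simp add: dtt_def dt_def[where u = "dt T u"])
  then show "(dt T u x has_real_derivative dtt T u x t) (at t within {0..T})"
    using d(2) unfolding has_real_derivative_iff_has_vector_derivative vector_derivative_works by simp
  show "m2 \<le> dtt T u x t" "dtt T u x t \<le> M2"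
    using assms unfolding regular_solution_def by auto
qed

text \<open>The heat equation enters here: the second space derivative is recorded as
  \<open>dt T u\<close>, so that bounds on time derivatives can be applied to it.\<close>

lemma regular_solution_space_derivatives:
  assumes "regular_solution I T m2 M2 u" "x \<in> I" "t \<in> {0..T}"
  shows "((\<lambda>y. u y t) has_real_derivative dx u x t) (at x)"
    and "((\<lambda>y. dx u y t) has_real_derivative dt T u x t) (at x)"
    and "dxx u x t = dt T u x t"
proof -
  have d: "(\<lambda>y. u y t) differentiable (at x)" "(\<lambda>y. dx u y t) differentiable (at x)"
    and e: "dt T u x t = dxx u x t"
    using assms unfolding regular_solution_def heat_solution_def by auto
  show "((\<lambda>y. u y t) has_real_derivative dx u x t) (at x)"
    using d(1) unfolding dx_def by (simp only: DERIV_deriv_iff_real_differentiable)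
  show "((\<lambda>y. dx u y t) has_real_derivative dt T u x t) (at x)"
    using d(2) unfolding e dxx_def dx_def[where u = "dx u"]
    by (simp only: DERIV_deriv_iff_real_differentiable)
  show "dxx u x t = dt T u x t" using e by simp
qed

lemma second_difference_dt_bounds:
  assumes reg: "regular_solution I T m2 M2 u" and T: "0 < T" and t: "t \<in> {0..T}"
    and r: "0 \<le> r" and seg: "{x - r..x + r} \<subseteq> I"
  shows "m2 * r\<^sup>2 \<le> second_difference (\<lambda>y. dt T u y t) x r"
    and "second_difference (\<lambda>y. dt T u y t) x r \<le> M2 * r\<^sup>2"
proof -
  note td = regular_solution_time_derivatives[OF reg] and sd = regular_solution_space_derivatives[OF reg]
  define q where "q s y = (u y s - u y t) / (s - t)" for s y
  have lim: "((\<lambda>s. q s y) \<longlongrightarrow> dt T u y t) (at t within {0..T})" if "y \<in> I" for y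
    using td(1)[OF that t] unfolding q_def has_field_derivative_iff .
  have "x + r \<in> I" "x \<in> I" "x - r \<in> I" using seg r by auto
  then have lim2: "((\<lambda>s. second_difference (q s) x r)
      \<longlongrightarrow> second_difference (\<lambda>y. dt T u y t) x r) (at t within {0..T})"
    unfolding second_difference_def by (intro tendsto_intros lim)
  have bounds: "m2 * r\<^sup>2 \<le> second_difference (q s) x r \<and> second_difference (q s) x r \<le> M2 * r\<^sup>2"
    if s: "s \<in> {0..T}" "s \<noteq> t" for s
  proof -
    define q' where "q' y = (dx u y s - dx u y t) / (s - t)" for y
    define q'' where "q'' y = (dt T u y s - dt T u y t) / (s - t)" for y
    have d: "(q s has_real_derivative q' y) (at y)" "(q' has_real_derivative q'' y) (at y)"
      if "y \<in> {x - r..x + r}" for y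
    proof -
      have "y \<in> I" using that seg by auto
      then show "(q s has_real_derivative q' y) (at y)" "(q' has_real_derivative q'' y) (at y)"
        unfolding q_def q'_def q''_def using s t by (auto intro!: DERIV_cdivide DERIV_diff sd)
    qed
    \<comment> \<open>\<open>q'' y\<close> is a difference quotient of \<open>dt T u y\<close> in
      time, hence a value of \<open>dtt T u y\<close>.\<close>
    have b: "m2 \<le> q'' y \<and> q'' y \<le> M2" if "y \<in> {x - r..x + r}" for y
    proof -
      have y: "y \<in> I" using that seg by auto
      obtain z where z: "z \<in> {min t s..max t s}" "dt T u y s - dt T u y t = dtt T u y z * (s - t)"
        using has_real_derivative_mvt[OF td(2)[OF y] t s(1)] by blast
      then have "z \<in> {0..T}" using s t by auto
      moreover have "q'' y = dtt T u y z" unfolding q''_def z(2) using s by simp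
      ultimately show ?thesis using td(3,4)[OF y] by auto
    qed
    have b2: "2 * m2 \<le> q'' (x + v) + q'' (x - v)" "q'' (x + v) + q'' (x - v) \<le> 2 * M2"
      if "v \<in> {0..r}" for v
      using b[of "x + v"] b[of "x - v"] that by auto
    have "m2 * r\<^sup>2 \<le> second_difference (q s) x r"
      by (rule second_difference_ge[OF d, where p = "\<lambda>v. m2 * v\<^sup>2" and p' = "\<lambda>v. 2 * m2 * v"
            and p'' = "\<lambda>v. 2 * m2"])
         (use b2 r in \<open>auto intro!: derivative_eq_intros\<close>)
    moreover have "second_difference (q s) x r \<le> M2 * r\<^sup>2"
      by (rule second_difference_le[OF d, where p = "\<lambda>v. M2 * v\<^sup>2" and p' = "\<lambda>v. 2 * M2 * v"
            and p'' = "\<lambda>v. 2 * M2"])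
         (use b2 r in \<open>auto intro!: derivative_eq_intros\<close>)
    ultimately show ?thesis by simp
  qed
  have ev: "\<forall>\<^sub>F s in at t within {0..T}. s \<in> {0..T} \<and> s \<noteq> t"
    by (auto simp: eventually_at_filter)
  \<comment> \<open>As \<open>0 < T\<close>, every point of the closed time interval is a limit
    point of it, the two ends included, so the bounds pass to the limit.\<close>
  have nontriv: "at t within {0..T} \<noteq> bot"
    using t T by (auto simp: trivial_limit_within)
  show "m2 * r\<^sup>2 \<le> second_difference (\<lambda>y. dt T u y t) x r"
    by (rule tendsto_lowerbound[OF lim2 _ nontriv]) (use ev bounds in \<open>auto elim: eventually_mono\<close>)
  show "second_difference (\<lambda>y. dt T u y t) x r \<le> M2 * r\<^sup>2"
    by (rule tendsto_upperbound[OF lim2 _ nontriv]) (use ev bounds in \<open>auto elim: eventually_mono\<close>)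
qed

lemma second_difference_solution_bound:
  assumes reg: "regular_solution I T m2 M2 u" and T: "0 < T" and t: "t \<in> {0..T}"
    and h: "0 \<le> h" and seg: "{x - h..x + h} \<subseteq> I"
  shows "\<bar>second_difference (\<lambda>y. u y t) x h - dt T u x t * h\<^sup>2\<bar> \<le> max \<bar>m2\<bar> \<bar>M2\<bar> / 12 * h ^ 4"
proof -
  let ?w = "dt T u x t" and ?K = "max \<bar>m2\<bar> \<bar>M2\<bar>"
  have d: "((\<lambda>y. u y t) has_real_derivative dx u y t) (at y)"
    "((\<lambda>y. dx u y t) has_real_derivative dt T u y t) (at y)" if "y \<in> {x - h..x + h}" for y
    using regular_solution_space_derivatives[OF reg _ t] that seg by auto
  have b: "2 * ?w + m2 * s\<^sup>2 \<le> dt T u (x + s) t + dt T u (x - s) t"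
    "dt T u (x + s) t + dt T u (x - s) t \<le> 2 * ?w + M2 * s\<^sup>2" if "s \<in> {0..h}" for s
  proof -
    have "0 \<le> s" "{x - s..x + s} \<subseteq> I" using that seg by auto
    from second_difference_dt_bounds[OF reg T t this]
    show "2 * ?w + m2 * s\<^sup>2 \<le> dt T u (x + s) t + dt T u (x - s) t"
      "dt T u (x + s) t + dt T u (x - s) t \<le> 2 * ?w + M2 * s\<^sup>2"
      by (auto simp: second_difference_def)
  qed
  \<comment> \<open>The comparison function integrates \<open>2 * ?w + m2 * v\<^sup>2\<close> twice
    from \<open>0\<close>; the factor 1/12 comes from integrating \<open>v\<^sup>2\<close>
    twice.\<close>
  have "?w * h\<^sup>2 + m2 / 12 * h ^ 4 \<le> second_difference (\<lambda>y. u y t) x h"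
    by (rule second_difference_ge[OF d, where p = "\<lambda>v. ?w * v\<^sup>2 + m2 / 12 * v ^ 4"
          and p' = "\<lambda>v. 2 * ?w * v + m2 / 3 * v ^ 3" and p'' = "\<lambda>v. 2 * ?w + m2 * v\<^sup>2"])
       (use b h in \<open>auto intro!: derivative_eq_intros\<close>)
  moreover have "second_difference (\<lambda>y. u y t) x h \<le> ?w * h\<^sup>2 + M2 / 12 * h ^ 4"
    by (rule second_difference_le[OF d, where p = "\<lambda>v. ?w * v\<^sup>2 + M2 / 12 * v ^ 4"
          and p' = "\<lambda>v. 2 * ?w * v + M2 / 3 * v ^ 3" and p'' = "\<lambda>v. 2 * ?w + M2 * v\<^sup>2"])
       (use b h in \<open>auto intro!: derivative_eq_intros\<close>)
  moreover have "M2 / 12 * h ^ 4 \<le> ?K / 12 * h ^ 4" "- ?K / 12 * h ^ 4 \<le> m2 / 12 * h ^ 4"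
    by (rule mult_right_mono, linarith, simp)+
  ultimately show ?thesis by (intro abs_leI) linarith+
qed

section \<open>Time errors of the two schemes\<close>

lemma step_times_in_range:
  fixes k :: real
  assumes "0 < k" "real (n + 1) * k \<le> T"
  shows "real n * k \<in> {0..T}" "real n * k + k \<in> {0..T}"
  using assms by (auto simp: algebra_simps)

text \<open>Replacing \<open>dxx u\<close> at the later time by \<open>dt T u\<close> turns
  \<open>2 * fd2_eps\<close> into the expression of \<open>trapezoid_bound\<close> for
  \<open>u x\<close> over one time step.\<close>

lemma fd2_eps_bound:
  assumes reg: "regular_solution I T m2 M2 u" and k: "0 < k" "real (n + 1) * k \<le> T" and x: "x \<in> I"
  shows "\<bar>2 * fd2_eps T k u x n\<bar> \<le> fd2_bound m2 M2 k"
proof -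
  note t = step_times_in_range[OF k] and td = regular_solution_time_derivatives[OF reg x]
  have e: "real (n + 1) * k = real n * k + k" by (simp add: algebra_simps)
  have "\<bar>2 / k * (u x (real n * k + k) - u x (real n * k)) - dt T u x (real n * k + k)
      - dt T u x (real n * k)\<bar> \<le> k / 4 * (M2 - m2)"
    by (rule trapezoid_bound[OF td(1,2)]) (use td t k in auto)
  moreover have "2 * fd2_eps T k u x n = 2 / k * (u x (real n * k + k) - u x (real n * k))
      - dt T u x (real n * k + k) - dt T u x (real n * k)"
    unfolding fd2_eps_def e regular_solution_space_derivatives(3)[OF reg x t(2)] by simp
  ultimately show ?thesis by (simp only: fd2_bound_def)
qed

text \<open>A single Taylor expansion from the earlier time. There is no second remainder to
  subtract, so the size of the second derivative enters rather than its oscillation.\<close>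

lemma classical_eps_bound:
  assumes reg: "regular_solution I T m2 M2 u" and k: "0 < k" "real (n + 1) * k \<le> T" and x: "x \<in> I"
  shows "\<bar>classical_eps T k u x n\<bar> \<le> classical_bound m2 M2 k"
proof -
  let ?a = "real n * k" and ?K = "max \<bar>m2\<bar> \<bar>M2\<bar>"
  note t = step_times_in_range[OF k] and td = regular_solution_time_derivatives[OF reg x]
  have e: "real (n + 1) * k = ?a + k" by (simp add: algebra_simps)
  have "m2 / 2 * k\<^sup>2 \<le> u x (?a + k) - u x ?a - dt T u x ?a * k"
    "u x (?a + k) - u x ?a - dt T u x ?a * k \<le> M2 / 2 * k\<^sup>2"
    using taylor2_bounds[OF td(1,2) _ t, of m2 M2] td(3,4) by auto
  moreover have "M2 / 2 * k\<^sup>2 \<le> ?K / 2 * k\<^sup>2" "- ?K / 2 * k\<^sup>2 \<le> m2 / 2 * k\<^sup>2"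
    by (rule mult_right_mono, linarith, simp)+
  ultimately have "\<bar>u x (?a + k) - u x ?a - dt T u x ?a * k\<bar> \<le> ?K / 2 * k\<^sup>2"
    by (intro abs_leI) linarith+
  also have "u x (?a + k) - u x ?a - dt T u x ?a * k = - k * classical_eps T k u x n"
    unfolding classical_eps_def e using k by (simp add: field_simps)
  also have "?K / 2 * k\<^sup>2 = k * classical_bound m2 M2 k"
    by (simp add: classical_bound_def power2_eq_square)
  finally show ?thesis using k by (simp add: abs_mult)
qed

section \<open>Truncation error, accuracy and consistency\<close>

text \<open>This is the Crank-Nicolson form of the scheme, in which time and space errors can be
  separated.\<close>

lemma fd2_truncation_eq:
  fixes j :: int
  assumes "0 < k" "0 < h"
  defines "x \<equiv> real_of_int j * h"
  shows "fd2_truncation k h u j n =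
    (u x (real (n + 1) * k) - u x (real n * k)) / k
    - (second_difference (\<lambda>y. u y (real (n + 1) * k)) x h / h\<^sup>2
       + second_difference (\<lambda>y. u y (real n * k)) x h / h\<^sup>2) / 2"
proof -
  have "real_of_int (j - 1) * h = x - h" "real_of_int (j + 1) * h = x + h"
    by (auto simp: x_def algebra_simps)
  then show ?thesis
    unfolding fd2_truncation_def fd2_lhs_def fd2_rhs_def grid_fn_def second_difference_def
    using assms(1,2) by (simp add: x_def[symmetric] field_simps)
qed

lemma fd2_truncation_bound:
  assumes reg: "regular_solution I T m2 M2 u" and T: "0 < T" and kh: "0 < k" "0 < h"
    and adm: "admissible I T k h j n"
  shows "\<bar>fd2_truncation k h u j n\<bar> \<le> k / 8 * (M2 - m2) + max \<bar>m2\<bar> \<bar>M2\<bar> / 12 * h\<^sup>2"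
proof -
  let ?K = "max \<bar>m2\<bar> \<bar>M2\<bar>"
  define x where "x = real_of_int j * h"
  have "real_of_int (j - 1) * h = x - h" "real_of_int (j + 1) * h = x + h"
    by (auto simp: x_def algebra_simps)
  then have seg: "{x - h..x + h} \<subseteq> I" and kT: "real (n + 1) * k \<le> T"
    using adm unfolding admissible_def by auto
  have x: "x \<in> I" using seg kh by auto
  have t: "real n * k \<in> {0..T}" "real (n + 1) * k \<in> {0..T}"
    using kT kh by (auto simp: algebra_simps)
  define D where "D s = second_difference (\<lambda>y. u y s) x h / h\<^sup>2 - dt T u x s" for s
  have D: "\<bar>D s\<bar> \<le> ?K / 12 * h\<^sup>2" if "s \<in> {0..T}" for s
  proof -
    have "second_difference (\<lambda>y. u y s) x h - dt T u x s * h\<^sup>2 = h\<^sup>2 * D s"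
      using kh by (simp add: D_def field_simps)
    moreover have "?K / 12 * h ^ 4 = h\<^sup>2 * (?K / 12 * h\<^sup>2)" by (simp add: power4_eq_xxxx power2_eq_square)
    ultimately have "\<bar>h\<^sup>2 * D s\<bar> \<le> h\<^sup>2 * (?K / 12 * h\<^sup>2)"
      using second_difference_solution_bound[OF reg T that less_imp_le[OF kh(2)] seg] by (simp only:)
    then show ?thesis using kh by (simp add: abs_mult)
  qed
  \<comment> \<open>The time error is \<open>fd2_eps\<close>, which is half of the bounded quantity,
    whence \<open>k / 8\<close>; the space error is the mean of \<open>D\<close> over the two time
    levels.\<close>
  have "fd2_truncation k h u j n =
      fd2_eps T k u x n - D (real (n + 1) * k) / 2 - D (real n * k) / 2"
    unfolding fd2_truncation_eq[OF kh] fd2_eps_def D_def x_def[symmetric]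
      regular_solution_space_derivatives(3)[OF reg x t(2)]
    by (simp add: diff_divide_distrib add_divide_distrib)
  moreover have "\<bar>2 * fd2_eps T k u x n\<bar> \<le> k / 4 * (M2 - m2)"
    using fd2_eps_bound[OF reg kh(1) kT x] by (simp add: fd2_bound_def)
  ultimately show ?thesis using D[OF t(1)] D[OF t(2)] by linarith
qed

lemma fd2_accurate:
  assumes "0 < T"
  shows "accurate_of_order I T 1 2 fd2_truncation"
  unfolding accurate_of_order_def
proof (intro allI impI)
  fix u m2 M2 assume reg: "regular_solution I T m2 M2 u"
  let ?K = "max \<bar>m2\<bar> \<bar>M2\<bar>"
  have "\<bar>fd2_truncation k h u j n\<bar> \<le> ?K * (k ^ 1 + h ^ 2)"
    if "0 < k" "0 < h" "admissible I T k h j n" for k h j n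
  proof -
    \<comment> \<open>\<open>M2 - m2\<close> is at most \<open>2 * ?K\<close>, so the factor 1/8
      leaves ample room.\<close>
    have "(M2 - m2) / 8 * k \<le> ?K * k" using that by (intro mult_right_mono) auto
    then have "k / 8 * (M2 - m2) \<le> ?K * k" by (simp add: mult.commute)
    moreover have "?K / 12 * h\<^sup>2 \<le> ?K * h\<^sup>2" by (intro mult_right_mono) auto
    ultimately show ?thesis
      using fd2_truncation_bound[OF reg assms that] unfolding distrib_left power_one_right
      by linarith
  qed
  then show "\<exists>C. \<exists>d>0. \<forall>k h j n. 0 < k \<and> k < d \<and> 0 < h \<and> h < d \<and> admissible I T k h j n \<longrightarrow>
      \<bar>fd2_truncation k h u j n\<bar> \<le> C * (k ^ 1 + h ^ 2)"
    by (intro exI[of _ ?K] exI[of _ 1]) auto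
qed

lemma accurate_imp_consistent:
  assumes acc: "accurate_of_order I T p q \<tau>" and pq: "0 < p" "0 < q"
  shows "consistent_with_heat I T \<tau>"
  unfolding consistent_with_heat_def
proof (intro allI impI)
  fix u m2 M2 and e :: real
  assume "regular_solution I T m2 M2 u" and e: "0 < e"
  then obtain C d where d: "0 < d" and C: "\<And>k h j n. 0 < k \<Longrightarrow> k < d \<Longrightarrow> 0 < h \<Longrightarrow> h < d \<Longrightarrow>
      admissible I T k h j n \<Longrightarrow> \<bar>\<tau> k h u j n\<bar> \<le> C * (k ^ p + h ^ q)"
    using acc unfolding accurate_of_order_def by meson
  \<comment> \<open>The bound \<open>1\<close> makes the powers at most \<open>k\<close> and
    \<open>h\<close>, so their sum is below \<open>2 * d'\<close>; the last entry then gives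
    \<open>e\<close>. \<open>\<bar>C\<bar> + 1\<close> is a positive substitute for
    \<open>C\<close>, whose sign is unknown.\<close>
  define d' where "d' = min d (min 1 (e / (2 * (\<bar>C\<bar> + 1))))"
  have d': "0 < d'" "d' \<le> d" "d' \<le> 1" "d' \<le> e / (2 * (\<bar>C\<bar> + 1))"
    using d e by (auto simp: d'_def)
  have "\<bar>\<tau> k h u j n\<bar> < e"
    if "0 < k" "k < d'" "0 < h" "h < d'" "admissible I T k h j n" for k h j n
  proof -
    have "k ^ p \<le> k ^ 1" "h ^ q \<le> h ^ 1"
      by (rule power_decreasing; use that d' pq in linarith)+
    then have "k ^ p + h ^ q < 2 * d'" using that by simp
    have "\<bar>\<tau> k h u j n\<bar> \<le> C * (k ^ p + h ^ q)" using C that d' by auto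
    also have "\<dots> \<le> (\<bar>C\<bar> + 1) * (k ^ p + h ^ q)" using that by (intro mult_right_mono) auto
    also have "\<dots> < (\<bar>C\<bar> + 1) * (2 * d')"
      using \<open>k ^ p + h ^ q < 2 * d'\<close> by (intro mult_strict_left_mono) auto
    also have "\<dots> \<le> e" using d'(4) by (simp add: pos_le_divide_eq mult_ac)
    finally show ?thesis .
  qed
  then show "\<exists>d>0. \<forall>k h j n. 0 < k \<and> k < d \<and> 0 < h \<and> h < d \<and> admissible I T k h j n \<longrightarrow>
      \<bar>\<tau> k h u j n\<bar> < e"
    using d'(1) by blast
qed

section \<open>Fourier modes and von Neumann stability\<close>

text \<open>Moving to a neighbouring node multiplies the mode by \<open>z\<close> or
  \<open>inverse z\<close>, whose sum is a real cosine; the nonzero spatial factor \<open>E\<close>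
  then cancels. The power \<open>A ^ n\<close> is kept, since \<open>A\<close> may be zero.\<close>

lemma FD2_fourier_mode_iff:
  "FD2 k h (fourier_mode h p A) j n \<longleftrightarrow>
     A ^ n * (A * of_real (1 + k / h\<^sup>2 * (1 - cos (p * h)))) =
     A ^ n * of_real (1 - k / h\<^sup>2 * (1 - cos (p * h)))"
proof -
  define E where "E = exp (\<i> * of_real (p * (real_of_int j * h)))"
  define z where "z = exp (\<i> * of_real (p * h))"
  define r where "r = k / h\<^sup>2"
  have cz: "inverse z + z = 2 * of_real (cos (p * h))"
    unfolding z_def cis_conv_exp[symmetric] by (simp add: complex_eq_iff)
  have m: "fourier_mode h p A j i = A ^ i * E"
    "fourier_mode h p A (j + 1) i = A ^ i * (E * z)"
    "fourier_mode h p A (j - 1) i = A ^ i * (E * inverse z)" for i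
    unfolding fourier_mode_def E_def z_def
    by (simp_all add: algebra_simps exp_add exp_diff exp_minus divide_inverse)
  have r2: "k / (2 * h\<^sup>2) = r / 2" by (simp add: r_def)
  have "fd2_lhs k h (fourier_mode h p A) j n =
      E * (A ^ n * (A * (1 + of_real r - of_real r / 2 * (inverse z + z))))"
    unfolding fd2_lhs_def m r2 r_def[symmetric] by (simp add: scaleR_conv_of_real algebra_simps)
  also have "\<dots> = E * (A ^ n * (A * of_real (1 + r * (1 - cos (p * h)))))"
    unfolding cz by (simp add: algebra_simps)
  finally have lhs: "fd2_lhs k h (fourier_mode h p A) j n = \<dots>" .
  have "fd2_rhs k h (fourier_mode h p A) j n =
      E * (A ^ n * (1 - of_real r + of_real r / 2 * (inverse z + z)))"
    unfolding fd2_rhs_def m r2 r_def[symmetric] by (simp add: scaleR_conv_of_real algebra_simps)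
  also have "\<dots> = E * (A ^ n * of_real (1 - r * (1 - cos (p * h))))"
    unfolding cz by (simp add: algebra_simps)
  finally have rhs: "fd2_rhs k h (fourier_mode h p A) j n = \<dots>" .
  have "E \<noteq> 0" by (simp add: E_def)
  then show ?thesis
    unfolding FD2_def lhs rhs r_def[symmetric] by (simp only: mult_cancel_left simp_thms)
qed

lemma FD2_unconditionally_stable: "unconditionally_stable FD2"
  unfolding unconditionally_stable_def von_neumann_stable_def
proof (intro allI impI conjI)
  fix k h p :: real assume k: "0 < k" and h: "0 < h"
  define c where "c = k / h\<^sup>2 * (1 - cos (p * h))"
  have c: "0 \<le> c" using k by (simp add: c_def)
  have nz: "complex_of_real (1 + c) \<noteq> 0" using c by (simp only: of_real_eq_0_iff)
  note iff = FD2_fourier_mode_iff[of k h p, folded c_def]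
  show "\<exists>A. \<forall>j n. FD2 k h (fourier_mode h p A) j n"
    by (intro exI[of _ "of_real (1 - c) / of_real (1 + c)"] allI)
       (use nz in \<open>simp add: iff del: of_real_add of_real_diff\<close>)
  fix A assume "\<forall>j n. FD2 k h (fourier_mode h p A) j n"
  \<comment> \<open>At \<open>n = 0\<close> the factor \<open>A ^ n\<close> is \<open>1\<close>, so
    the equation for \<open>A\<close> follows even if \<open>A\<close> is zero.\<close>
  then have "A * of_real (1 + c) = of_real (1 - c)"
    using iff[of A 0 0] by simp
  then have "cmod A * \<bar>1 + c\<bar> = \<bar>1 - c\<bar>" by (metis norm_mult norm_of_real)
  \<comment> \<open>\<open>\<bar>1 - c\<bar>\<close> is at most \<open>1 + c\<close> because
    \<open>c\<close> is nonnegative, whatever the ratio of \<open>k\<close> to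
    \<open>h\<^sup>2\<close>.\<close>
  then have "cmod A * (1 + c) \<le> 1 * (1 + c)" using c by simp
  then show "cmod A \<le> 1" using c by (simp add: mult_le_cancel_right)
qed

theorem theorem4p1:
  fixes I :: "real set" and T :: real
  assumes "open I" and "T > 0"
  shows "consistent_with_heat I T fd2_truncation \<and>
    accurate_of_order I T 1 2 fd2_truncation \<and>
    (\<forall>u m2 M2 k. regular_solution I T m2 M2 u \<and> k > 0 \<longrightarrow>
       (\<forall>x\<in>I. \<forall>n. real (n + 1) * k \<le> T \<longrightarrow>
          \<bar>classical_eps T k u x n\<bar> \<le> classical_bound m2 M2 k \<and>
          \<bar>2 * fd2_eps T k u x n\<bar> \<le> fd2_bound m2 M2 k) \<and>
       (m2 \<ge> 0 \<longrightarrow> 2 * fd2_bound m2 M2 k \<le> classical_bound m2 M2 k)) \<and>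
    (I = UNIV \<longrightarrow> unconditionally_stable FD2)"
proof -
  have "2 * fd2_bound m2 M2 k \<le> classical_bound m2 M2 k" if "0 < k" "0 \<le> m2" for m2 M2 k
  proof -
    \<comment> \<open>With \<open>m2\<close> nonnegative, \<open>M2 - m2\<close> is at most
      \<open>M2\<close>; doubling \<open>k / 4\<close> gives the factor \<open>k / 2\<close> of the
      classical bound.\<close>
    have "k / 2 * (M2 - m2) \<le> k / 2 * max \<bar>m2\<bar> \<bar>M2\<bar>"
      using that by (intro mult_left_mono) auto
    then show ?thesis by (simp add: fd2_bound_def classical_bound_def)
  qed
  then show ?thesis
    using fd2_accurate[OF assms(2)] accurate_imp_consistent[OF fd2_accurate[OF assms(2)]]
      classical_eps_bound fd2_eps_bound FD2_unconditionally_stable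
    by auto
qed

end
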